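(* For any $S\subseteq[n]$ and any $\pi\in\mathfrak S_n$, $\mathrm{Pin}(\pi)=\mathrm{Pin}(\varphi_S(\pi))$.
   Context: $[n]=\{1,\dots,n\}$ and $\mathfrak S_n$ is the set of permutations $\pi=\pi_1\cdots\pi_n$ of $[n]$ in one-line notation, with the convention $\pi_0=\pi_{n+1}=\infty$. The value $\pi_i$ ($i\in[n]$) is a pinnacle of $\pi$ if $\pi_{i-1}<\pi_i>\pi_{i+1}$; $\mathrm{Pin}(\pi)$ is the set of pinnacles of $\pi$. For $x\in[n]$, the $x$-factorization of $\pi$ is $\pi=w_1w_2\,x\,w_4w_5$ (concatenation of words), where $w_2$ is the longest contiguous (possibly empty) subword immediately to the left of $x$ all of whose letters are less than $x$, and $w_4$ is the longest contiguous (possibly empty) subword immediately to the right of $x$ all of whose letters are less than $x$. Define $\varphi_x(\pi)=w_1w_4\,x\,w_2w_5$. For $S\subseteq[n]$, $\varphi_S$ is the composition of the maps $\varphi_x$, $x\in S$ (in any order; these maps commute), with $\varphi_\emptyset$ the identity. *)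

theory Defs
  imports "HOL-Combinatorics.Multiset_Permutations" "HOL-Library.Extended_Nat"
begin

text \<open>
  A permutation of $[n]$ in one-line notation is a list in
  \<open>permutations_of_set {1..n}\<close>. Positions are counted from 1, so that \<open>entry p i\<close> is $\pi_i$,
  with $\pi_0 = \pi_{n+1} = \infty$.
\<close>

definition entry :: "nat list \<Rightarrow> nat \<Rightarrow> enat" where
  "entry p i = (if i \<in> {1..length p} then enat (p ! (i - 1)) else \<infinity>)"

definition Pin :: "nat list \<Rightarrow> nat set" where
  "Pin p = {p ! (i - 1) | i. i \<in> {1..length p} \<and>
              entry p (i - 1) < entry p i \<and> entry p i > entry p (i + 1)}"

text \<open>
  In the following, \<open>l\<close> and \<open>r\<close> are the words to the left and to the right of the letter \<open>x\<close>.
  The value is meaningful only if \<open>x\<close> occurs in \<open>p\<close>; compare \<open>phi_eq\<close> and \<open>x_fact_exists\<close> below.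
\<close>

definition phi :: "nat \<Rightarrow> nat list \<Rightarrow> nat list" where
  "phi x p =
     (let l = takeWhile (\<lambda>a. a \<noteq> x) p;
          r = tl (dropWhile (\<lambda>a. a \<noteq> x) p);
          w1 = rev (dropWhile (\<lambda>a. a < x) (rev l));
          w2 = rev (takeWhile (\<lambda>a. a < x) (rev l));
          w4 = takeWhile (\<lambda>a. a < x) r;
          w5 = dropWhile (\<lambda>a. a < x) r
      in w1 @ w4 @ [x] @ w2 @ w5)"

text \<open>
  The order chosen here for the composition (increasing in \<open>x\<close>) is immaterial: see
  \<open>phi_set_any_order\<close> below.
\<close>

definition phi_set :: "nat set \<Rightarrow> nat list \<Rightarrow> nat list" where
  "phi_set S p = fold phi (sorted_list_of_set S) p"

definition x_fact :: "nat \<Rightarrow> nat list \<Rightarrow> nat list \<Rightarrow> nat list \<Rightarrow> nat list \<Rightarrow> bool" where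
  "x_fact x w1 w2 w4 w5 \<longleftrightarrow>
     x \<notin> set w1 \<and> (\<forall>a \<in> set w2 \<union> set w4. a < x) \<and>
     (w1 = [] \<or> \<not> last w1 < x) \<and> (w5 = [] \<or> \<not> hd w5 < x)"

lemma phi_eq:
  assumes "x_fact x w1 w2 w4 w5"
  shows "phi x (w1 @ w2 @ [x] @ w4 @ w5) = w1 @ w4 @ [x] @ w2 @ w5"
proof -
  have n: "\<forall>a \<in> set (w1 @ w2). a \<noteq> x" using assms by (auto simp: x_fact_def)
  have l: "takeWhile (\<lambda>a. a \<noteq> x) (w1 @ w2 @ [x] @ w4 @ w5) = w1 @ w2"
    using n takeWhile_append2[of "w1 @ w2" "\<lambda>a. a \<noteq> x" "[x] @ w4 @ w5"] by simp
  have r: "dropWhile (\<lambda>a. a \<noteq> x) (w1 @ w2 @ [x] @ w4 @ w5) = [x] @ w4 @ w5"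
    using n dropWhile_append2[of "w1 @ w2" "\<lambda>a. a \<noteq> x" "[x] @ w4 @ w5"] by simp
  have a: "takeWhile (\<lambda>a. a < x) w5 = []" "dropWhile (\<lambda>a. a < x) w5 = w5"
    using assms by (cases w5; auto simp: x_fact_def)+
  have b: "takeWhile (\<lambda>a. a < x) (rev w1) = []" "dropWhile (\<lambda>a. a < x) (rev w1) = rev w1"
    using assms by (cases w1 rule: rev_cases; auto simp: x_fact_def)+
  have c: "takeWhile (\<lambda>a. a < x) (w4 @ w5) = w4" "dropWhile (\<lambda>a. a < x) (w4 @ w5) = w5"
    using assms a by (auto simp: x_fact_def takeWhile_append2 dropWhile_append2)
  have "\<And>a. a \<in> set (rev w2) \<Longrightarrow> a < x" using assms by (auto simp: x_fact_def)
  then have d: "takeWhile (\<lambda>a. a < x) (rev w2 @ rev w1) = rev w2"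
    "dropWhile (\<lambda>a. a < x) (rev w2 @ rev w1) = rev w1"
    using b takeWhile_append2[of "rev w2" "\<lambda>a. a < x" "rev w1"]
      dropWhile_append2[of "rev w2" "\<lambda>a. a < x" "rev w1"] by simp_all
  show ?thesis unfolding phi_def l r Let_def by (simp add: c d)
qed

lemma x_fact_exists:
  assumes "x \<in> set p"
  obtains w1 w2 w4 w5 where "p = w1 @ w2 @ [x] @ w4 @ w5" "x_fact x w1 w2 w4 w5"
proof -
  obtain l r where p: "p = l @ x # r" and l: "x \<notin> set l"
    using split_list_first[OF assms] by blast
  define w1 w2 where "w1 = rev (dropWhile (\<lambda>a. a < x) (rev l))"
    and "w2 = rev (takeWhile (\<lambda>a. a < x) (rev l))"
  define w4 w5 where "w4 = takeWhile (\<lambda>a. a < x) r" and "w5 = dropWhile (\<lambda>a. a < x) r"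
  have l12: "l = w1 @ w2" unfolding w1_def w2_def
    by (metis rev_append rev_rev_ident takeWhile_dropWhile_id)
  have "r = w4 @ w5" unfolding w4_def w5_def by simp
  moreover have "w1 = [] \<or> \<not> last w1 < x" unfolding w1_def
    using hd_dropWhile[of "\<lambda>a. a < x" "rev l"] by (auto simp: last_rev)
  moreover have "w5 = [] \<or> \<not> hd w5 < x" unfolding w5_def
    using hd_dropWhile[of "\<lambda>a. a < x" r] by auto
  moreover have "\<forall>a \<in> set w2 \<union> set w4. a < x"
    unfolding w2_def w4_def by (auto dest: set_takeWhileD)
  ultimately show thesis using that[of w1 w2 w4 w5] p l l12 by (auto simp: x_fact_def)
qed

lemma mset_phi: "x \<in> set p \<Longrightarrow> mset (phi x p) = mset p"
  by (erule x_fact_exists) (simp only: phi_eq, simp)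

lemma set_phi: "x \<in> set p \<Longrightarrow> set (phi x p) = set p"
  using mset_phi mset_eq_setD by blast

lemma distinct_phi: "x \<in> set p \<Longrightarrow> distinct (phi x p) = distinct p"
  using mset_phi mset_eq_imp_distinct_iff by blast

lemma phi_local:
  assumes "x \<in> set B" "x \<notin> set A" "A = [] \<or> x < last A" "C = [] \<or> x < hd C"
  shows "phi x (A @ B @ C) = A @ phi x B @ C"
proof -
  obtain w1 w2 w4 w5 where B: "B = w1 @ w2 @ [x] @ w4 @ w5" and f: "x_fact x w1 w2 w4 w5"
    using x_fact_exists[OF assms(1)] .
  have f': "x_fact x (A @ w1) w2 w4 (w5 @ C)"
    using f assms by (auto simp: x_fact_def last_append hd_append)
  show ?thesis using phi_eq[OF f] phi_eq[OF f'] by (simp add: B)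
qed

lemma last_phi:
  assumes "x \<in> set p" "x < last p" "distinct p"
  shows "last (phi x p) = last p"
proof (cases p rule: rev_cases)
  case (snoc q z)
  then show ?thesis using phi_local[of x q "[]" "[z]"] assms by auto
qed (use assms in auto)

lemma hd_phi:
  assumes "x \<in> set p" "x < hd p" "distinct p"
  shows "hd (phi x p) = hd p"
proof (cases p)
  case (Cons z q)
  then show ?thesis using phi_local[of x q "[z]" "[]"] assms by auto
qed (use assms in auto)

lemma phi_commute_less:
  assumes d: "distinct p" and x: "x \<in> set p" and y: "y \<in> set p" and xy: "x < y"
  shows "phi x (phi y p) = phi y (phi x p)"
proof -
  obtain w1 w2 w4 w5 where p: "p = w1 @ w2 @ [y] @ w4 @ w5" and f: "x_fact y w1 w2 w4 w5"
    using x_fact_exists[OF y] .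
  have py: "phi y p = w1 @ w4 @ [y] @ w2 @ w5" using phi_eq[OF f] p by simp
  have l1: "w1 = [] \<or> y < last w1"
    using f unfolding x_fact_def by (metis last_in_set linorder_neqE_nat)
  have h5: "w5 = [] \<or> y < hd w5"
  proof -
    have "y \<notin> set w5" using d p by simp
    then show ?thesis using f unfolding x_fact_def by (metis hd_in_set linorder_neqE_nat)
  qed
  have ne: "v \<noteq> []" if "x \<in> set v" for v using that by auto
  consider "x \<in> set w1" | "x \<in> set w2" | "x \<in> set w4" | "x \<in> set w5"
    using x p xy by auto
  then show ?thesis
  proof cases
    case 1
    have w1: "w1 \<noteq> []" "x < last w1" using 1 l1 xy by auto
    have d1: "distinct w1" using d p by simp
    have la: "last (phi x w1) = last w1" using last_phi[OF 1 w1(2) d1] .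
    have loc: "phi x (w1 @ v) = phi x w1 @ v" if "v = w2 @ [y] @ w4 @ w5 \<or> v = w4 @ [y] @ w2 @ w5" for v
    proof -
      obtain q z where q: "w1 = q @ [z]" using w1 by (cases w1 rule: rev_cases) auto
      have xq: "x \<in> set q" and z: "x < z" using 1 w1 q by auto
      have "phi x ([] @ q @ ([z] @ v)) = phi x q @ [z] @ v"
        using xq z by (subst phi_local) auto
      moreover have "phi x ([] @ q @ [z]) = phi x q @ [z]"
        using xq z by (subst phi_local) auto
      ultimately show ?thesis by (simp add: q)
    qed
    have f': "x_fact y (phi x w1) w2 w4 w5"
      using f la set_phi[OF 1] l1 1 by (auto simp: x_fact_def)
    show ?thesis unfolding py using loc phi_eq[OF f'] by (simp add: p)
  next
    case 2
    have f': "x_fact y w1 (phi x w2) w4 w5" using f set_phi[OF 2] by (auto simp: x_fact_def)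
    have "phi x p = w1 @ phi x w2 @ ([y] @ w4 @ w5)"
      unfolding p using 2 d p l1 xy by (subst phi_local) auto
    moreover have "phi x ((w1 @ w4 @ [y]) @ w2 @ w5) = (w1 @ w4 @ [y]) @ phi x w2 @ w5"
      using 2 d p h5 xy by (subst phi_local) auto
    ultimately show ?thesis unfolding py using phi_eq[OF f'] by simp
  next
    case 3
    have f': "x_fact y w1 w2 (phi x w4) w5" using f set_phi[OF 3] by (auto simp: x_fact_def)
    have "phi x ((w1 @ w2 @ [y]) @ w4 @ w5) = (w1 @ w2 @ [y]) @ phi x w4 @ w5"
      using 3 d p h5 xy by (subst phi_local) auto
    moreover have "phi x (w1 @ w4 @ ([y] @ w2 @ w5)) = w1 @ phi x w4 @ ([y] @ w2 @ w5)"
      using 3 d p l1 xy by (subst phi_local) auto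
    ultimately show ?thesis unfolding py using phi_eq[OF f'] by (simp add: p)
  next
    case 4
    have w5: "w5 \<noteq> []" "x < hd w5" using 4 h5 xy by auto
    have d5: "distinct w5" using d p by simp
    have ha: "hd (phi x w5) = hd w5" using hd_phi[OF 4 w5(2) d5] .
    obtain z q where q: "w5 = z # q" using w5 by (cases w5) auto
    have xq: "x \<in> set q" and z: "x < z" using 4 w5 q by auto
    have loc: "phi x (v @ w5) = v @ phi x w5" if "x \<notin> set v" for v
    proof -
      have "phi x ((v @ [z]) @ q @ []) = (v @ [z]) @ phi x q @ []"
        using xq z that by (subst phi_local) auto
      moreover have "phi x ([z] @ q @ []) = [z] @ phi x q @ []"
        using xq z by (subst phi_local) auto
      ultimately show ?thesis by (simp add: q)
    qed
    have f': "x_fact y w1 w2 w4 (phi x w5)"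
      using f ha h5 4 by (auto simp: x_fact_def)
    have "phi x ((w1 @ w2 @ [y] @ w4) @ w5) = (w1 @ w2 @ [y] @ w4) @ phi x w5"
      using 4 d p by (intro loc) auto
    moreover have "phi x ((w1 @ w4 @ [y] @ w2) @ w5) = (w1 @ w4 @ [y] @ w2) @ phi x w5"
      using 4 d p by (intro loc) auto
    ultimately show ?thesis unfolding py using phi_eq[OF f'] by (simp add: p)
  qed
qed

lemma phi_commute:
  assumes "distinct p" "x \<in> set p" "y \<in> set p"
  shows "phi x (phi y p) = phi y (phi x p)"
  using phi_commute_less[of p x y] phi_commute_less[of p y x] assms
  by (cases x y rule: linorder_cases) auto

lemma phi_set_any_order:
  assumes p: "p \<in> permutations_of_set {1..n}" and S: "S \<subseteq> {1..n}"
    and xs: "distinct xs" "set xs = S"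
  shows "fold phi xs p = phi_set S p"
proof -
  define g where "g x q = (if distinct q \<and> x \<in> set q then phi x q else q)" for x q
  have comm: "g x \<circ> g y = g y \<circ> g x" for x y
    by (rule ext) (simp add: g_def phi_commute set_phi distinct_phi)
  have pp: "distinct p" "set p = {1..n}" using p by (auto simp: permutations_of_set_def)
  have fg: "fold phi zs q = fold g zs q"
    if "distinct q" "set zs \<subseteq> set q" for zs q
    using that by (induction zs arbitrary: q) (auto simp: g_def set_phi distinct_phi)
  have fin: "finite S" using S finite_subset by blast
  have "mset xs = mset (sorted_list_of_set S)"
    using xs fin by (intro set_eq_iff_mset_eq_distinct[THEN iffD1]) auto
  then have "fold g xs = fold g (sorted_list_of_set S)"
    using comm by (intro fold_multiset_equiv) auto
  then show ?thesis unfolding phi_set_def using fg[of p xs] fg[of p "sorted_list_of_set S"] pp xs S fin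
    by simp
qed

end

theory Submission imports Defs
begin

text \<open>
  A pinnacle depends only on the comparisons of a letter with its two neighbours, so pinnacles can
  be computed factor by factor once each factor knows the letters that delimit it (its walls).
  In $w_1 w_2\, x\, w_4 w_5$ the letters of $w_2$ and $w_4$ are smaller than \<open>x\<close>, and the last letter
  of $w_1$ and the first letter of $w_5$ are larger than \<open>x\<close> (or are $\infty$). Hence, before and after
  the exchange of $w_2$ and $w_4$:
  \<^item> each of $w_2$, $w_4$ lies between two walls that exceed all its letters, and such walls
    can be replaced by any others of this kind (\<open>pins_cong\<close>);
  \<^item> the wall of $w_1$ on the right, and that of $w_5$ on the left, is at most \<open>x\<close>, hence smaller
    than the letter next to it;
  \<^item> \<open>x\<close> is a pinnacle exactly when $w_2$ and $w_4$ are both nonempty, a symmetric condition.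

  So a single \<open>phi x\<close> preserves the pinnacle set (\<open>Pin_phi\<close>). It also preserves the set of letters and
  their distinctness, so this can be iterated over any sequence of letters.
\<close>

definition last_or :: "enat \<Rightarrow> nat list \<Rightarrow> enat" where
  "last_or a w = (if w = [] then a else enat (last w))"

definition hd_or :: "nat list \<Rightarrow> enat \<Rightarrow> enat" where
  "hd_or w b = (if w = [] then b else enat (hd w))"

text \<open>
  The walls \<open>a\<close> and \<open>b\<close> stand for the letters adjacent to \<open>w\<close> in a longer word, with $\infty$ where
  that word ends. They are not counted as pinnacles of \<open>w\<close>, so that the pinnacles of a
  concatenation are the union of those of its factors.
\<close>

definition pins :: "enat \<Rightarrow> nat list \<Rightarrow> enat \<Rightarrow> nat set" where
  "pins a w b = {y. \<exists>u v. w = u @ y # v \<and> last_or a u < enat y \<and> hd_or v b < enat y}"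

lemma last_or_simps [simp]:
  "last_or a [] = a" "last_or a (u @ v) = last_or (last_or a u) v" "last_or a (x # w) = last_or (enat x) w"
  by (auto simp: last_or_def)

lemma hd_or_simps [simp]:
  "hd_or [] b = b" "hd_or (u @ v) b = hd_or u (hd_or v b)" "hd_or (x # w) b = enat x"
  by (auto simp: hd_or_def)

lemma pinsI:
  assumes "last_or a u < enat y" "hd_or v b < enat y"
  shows "y \<in> pins a (u @ y # v) b"
  using assms unfolding pins_def by blast

lemma pinsE:
  assumes "y \<in> pins a w b"
  obtains u v where "w = u @ y # v" "last_or a u < enat y" "hd_or v b < enat y"
  using assms unfolding pins_def by blast

lemma Pin_eq_pins: "Pin p = pins \<infinity> p \<infinity>"
proof (intro set_eqI iffI)
  fix y assume "y \<in> Pin p"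
  then obtain i where i: "y = p ! (i - 1)" "i \<in> {1..length p}"
    "entry p (i - 1) < entry p i" "entry p (i + 1) < entry p i"
    unfolding Pin_def by blast
  define u v where "u = take (i - 1) p" and "v = drop i p"
  have p: "p = u @ y # v" and len: "i = length u + 1"
    using i id_take_nth_drop[of "i - 1" p] by (auto simp: u_def v_def)
  have "last_or \<infinity> u = entry p (i - 1)" "hd_or v \<infinity> = entry p (i + 1)" "entry p i = enat y"
    unfolding p len by (auto simp: entry_def last_or_def hd_or_def nth_append last_conv_nth hd_conv_nth Suc_le_eq)
  with i(3,4) have "last_or \<infinity> u < enat y" "hd_or v \<infinity> < enat y" by simp_all
  then show "y \<in> pins \<infinity> p \<infinity>" unfolding p by (rule pinsI)
next
  fix y assume "y \<in> pins \<infinity> p \<infinity>"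
  then obtain u v where p: "p = u @ y # v" and lt: "last_or \<infinity> u < enat y" "hd_or v \<infinity> < enat y"
    by (rule pinsE)
  let ?i = "length u + 1"
  have "last_or \<infinity> u = entry p (?i - 1)" "hd_or v \<infinity> = entry p (?i + 1)" "entry p ?i = enat y"
    unfolding p by (auto simp: entry_def last_or_def hd_or_def nth_append last_conv_nth hd_conv_nth Suc_le_eq)
  with lt have "entry p (?i - 1) < entry p ?i" "entry p (?i + 1) < entry p ?i" by simp_all
  moreover have "y = p ! (?i - 1)" "?i \<in> {1..length p}" by (auto simp: p)
  ultimately show "y \<in> Pin p" unfolding Pin_def by blast
qed

lemma pins_Nil [simp]: "pins a [] b = {}"
  by (simp add: pins_def)

lemma pins_Cons:
  "pins a (x # w) b = (if a < enat x \<and> hd_or w b < enat x then {x} else {}) \<union> pins (enat x) w b"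
proof (intro set_eqI iffI)
  fix y assume "y \<in> pins a (x # w) b"
  then obtain u v where "x # w = u @ y # v" "last_or a u < enat y" "hd_or v b < enat y"
    by (rule pinsE)
  then show "y \<in> (if a < enat x \<and> hd_or w b < enat x then {x} else {}) \<union> pins (enat x) w b"
    by (cases u) (auto intro: pinsI)
next
  fix y assume "y \<in> (if a < enat x \<and> hd_or w b < enat x then {x} else {}) \<union> pins (enat x) w b"
  then consider "y = x" "a < enat x" "hd_or w b < enat x" | "y \<in> pins (enat x) w b"
    by (auto split: if_splits)
  then show "y \<in> pins a (x # w) b"
  proof cases
    case 1
    then show ?thesis using pinsI[of a "[]" x w b] by simp
  next
    case 2
    then obtain u v where "w = u @ y # v" "last_or (enat x) u < enat y" "hd_or v b < enat y"
      by (rule pinsE)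
    then show ?thesis using pinsI[of a "x # u" y v b] by simp
  qed
qed

lemma pins_append: "pins a (u @ v) b = pins a u (hd_or v b) \<union> pins (last_or a u) v b"
  by (induction u arbitrary: a) (auto simp: pins_Cons)

text \<open>
  A wall is only ever compared with the letter next to it, so only the outcome of that comparison matters. This
  is what allows a factor to be moved to a place with different neighbours.
\<close>

lemma pins_cong:
  assumes "w \<noteq> [] \<Longrightarrow> a < enat (hd w) \<longleftrightarrow> a' < enat (hd w)"
    and "w \<noteq> [] \<Longrightarrow> b < enat (last w) \<longleftrightarrow> b' < enat (last w)"
  shows "pins a w b = pins a' w b'"
proof -
  have "pins c w d \<subseteq> pins c' w d'"
    if "w \<noteq> [] \<Longrightarrow> c < enat (hd w) \<longleftrightarrow> c' < enat (hd w)"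
      and "w \<noteq> [] \<Longrightarrow> d < enat (last w) \<longleftrightarrow> d' < enat (last w)" for c c' d d'
  proof
    fix y assume "y \<in> pins c w d"
    then obtain u v where w: "w = u @ y # v" and lt: "last_or c u < enat y" "hd_or v d < enat y"
      by (rule pinsE)
    have "last_or c' u < enat y" using that(1) lt(1) w by (cases u) auto
    moreover have "hd_or v d' < enat y" using that(2) lt(2) w by (cases v) auto
    ultimately show "y \<in> pins c' w d'" unfolding w by (rule pinsI)
  qed
  from this[of a a' b b'] this[of a' a b' b] show ?thesis using assms by auto
qed

lemma pins_high_walls:
  assumes "\<forall>y \<in> set w. enat y < a \<and> enat y < b \<and> enat y < a' \<and> enat y < b'"
  shows "pins a w b = pins a' w b'"
  using assms by (intro pins_cong) (auto dest: bspec[OF _ hd_in_set] bspec[OF _ last_in_set] less_asym)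

lemma Pin_phi:
  assumes "distinct p" and "x \<in> set p"
  shows "Pin (phi x p) = Pin p"
proof -
  obtain w1 w2 w4 w5 where p: "p = w1 @ w2 @ [x] @ w4 @ w5" and f: "x_fact x w1 w2 w4 w5"
    using x_fact_exists[OF assms(2)] .
  let ?L = "last_or \<infinity> w1" and ?R = "hd_or w5 \<infinity>"
  have small: "y < x" if "y \<in> set w2 \<or> y \<in> set w4" for y
    using f that by (auto simp: x_fact_def)
  have L: "enat x < ?L"
    using f by (cases w1 rule: rev_cases) (auto simp: x_fact_def)
  \<comment> \<open>Distinctness rules out that the letter that stops $w_4$ is another copy of \<open>x\<close>.\<close>
  have "x \<notin> set w5" using assms(1) p by simp
  then have R: "enat x < ?R"
    using f by (cases w5) (auto simp: x_fact_def)
  have hd_le: "hd_or w (enat x) \<le> enat x" and last_le: "last_or (enat x) w \<le> enat x"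
    if "w = w2 \<or> w = w4" for w
    using that small by (auto simp: hd_or_def last_or_def less_imp_le)
  have w1: "pins \<infinity> w1 (hd_or w2 (enat x)) = pins \<infinity> w1 (hd_or w4 (enat x))"
    using le_less_trans[OF hd_le[of w2] L] le_less_trans[OF hd_le[of w4] L]
    by (intro pins_cong) (auto simp: last_or_def)
  have w5: "pins (last_or (enat x) w4) w5 \<infinity> = pins (last_or (enat x) w2) w5 \<infinity>"
    using le_less_trans[OF last_le[of w2] R] le_less_trans[OF last_le[of w4] R]
    by (intro pins_cong) (auto simp: hd_or_def)
  have lt: "enat y < enat x" "enat y < ?L" "enat y < ?R" if "y \<in> set w2 \<or> y \<in> set w4" for y
    using small[OF that] L R by (auto intro: less_trans[of "enat y" "enat x"])
  have w2: "pins ?L w2 (enat x) = pins (enat x) w2 ?R"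
    and w4: "pins (enat x) w4 ?R = pins ?L w4 (enat x)"
    by (intro pins_high_walls; use lt in blast)+
  have wall: "last_or ?L w < enat x \<longleftrightarrow> w \<noteq> []" "hd_or w ?R < enat x \<longleftrightarrow> w \<noteq> []"
    if "w = w2 \<or> w = w4" for w
    using that small L R by (auto simp: last_or_def hd_or_def dest: less_trans)
  show ?thesis
    using w1 w2 w4 w5 wall[of w2] wall[of w4]
    unfolding Pin_eq_pins p phi_eq[OF f] by (auto simp: pins_append pins_Cons)
qed

lemma Pin_fold_phi:
  assumes "distinct p" and "set xs \<subseteq> set p"
  shows "Pin (fold phi xs p) = Pin p"
  using assms by (induction xs arbitrary: p) (auto simp: Pin_phi set_phi distinct_phi)

theorem theorem2p3:
  fixes n :: nat and S :: "nat set" and p :: "nat list"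
  assumes "S \<subseteq> {1..n}" and "p \<in> permutations_of_set {1..n}"
  shows "Pin p = Pin (phi_set S p)"
proof -
  have "finite S" using assms(1) finite_subset by blast
  then show ?thesis
    using assms Pin_fold_phi[of p "sorted_list_of_set S"]
    by (simp add: phi_set_def permutations_of_set_def)
qed

end
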